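(* Let $L>0$ and let $\sigma_1<\sigma_2<\dots$ be the eigenvalues of the one-dimensional buckling problem $u''''=-\sigma u''$ on $(0,L)$, $u(0)=u'(0)=u(L)=u'(L)=0$. Then, as $z\to+\infty$, $$R_1(z)=\sum_j(z-\sigma_j)_+=\frac{2L}{3\pi}z^{\frac32}-\frac32 z+o(z).$$
   Context: $a_+=\max\{a,0\}$. The eigenvalue problem is understood in the weak sense in $H^2_0(0,L)$: $\int_0^L u''\phi''=\sigma\int_0^L u'\phi'$ for all $\phi\in H^2_0(0,L)$. *)

theory Defs
  imports "HOL-Analysis.Analysis" "HOL-Library.Landau_Symbols"
begin

text \<open>H^2_0(0,L) in one dimension: u is the double antiderivative (from 0) of an
  L^2 function u2 (its second weak derivative), with u1 = u' ; the conditions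
  u(0) = u'(0) = 0 are built in, and u(L) = u'(L) = 0 are imposed.\<close>
definition H2_0 :: "real \<Rightarrow> (real \<Rightarrow> real) \<Rightarrow> (real \<Rightarrow> real) \<Rightarrow> (real \<Rightarrow> real) \<Rightarrow> bool" where
  "H2_0 L u u1 u2 \<longleftrightarrow>
     u2 absolutely_integrable_on {0..L} \<and>
     (\<lambda>x. (u2 x)\<^sup>2) integrable_on {0..L} \<and>
     (\<forall>x\<in>{0..L}. u1 x = integral {0..x} u2) \<and>
     (\<forall>x\<in>{0..L}. u x = integral {0..x} u1) \<and>
     u1 L = 0 \<and> u L = 0"

definition buckling_eigenvalue :: "real \<Rightarrow> real \<Rightarrow> bool" where
  "buckling_eigenvalue L \<sigma> \<longleftrightarrow>
     (\<exists>u u1 u2. H2_0 L u u1 u2 \<and> (\<exists>x\<in>{0..L}. u x \<noteq> 0) \<and>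
        (\<forall>\<phi> \<phi>1 \<phi>2. H2_0 L \<phi> \<phi>1 \<phi>2 \<longrightarrow>
           integral {0..L} (\<lambda>x. u2 x * \<phi>2 x) = \<sigma> * integral {0..L} (\<lambda>x. u1 x * \<phi>1 x)))"

text \<open>Riesz mean R_1(z) = sum_j (z - sigma_j)_+ (eigenvalues are simple in 1D).\<close>
definition riesz_mean1 :: "real \<Rightarrow> real \<Rightarrow> real" where
  "riesz_mean1 L z = (\<Sum>\<sigma>\<in>{\<sigma>. buckling_eigenvalue L \<sigma> \<and> \<sigma> < z}. max (z - \<sigma>) 0)"

end

theory Submission
  imports Defs
begin

text \<open>A weak eigenfunction is a classical one: \<open>u'' + \<sigma> u\<close> is orthogonal to the second derivatives of
  all test functions, hence affine, so \<open>u\<close> is a combination of \<open>1 - cos (k x)\<close> and \<open>x - sin (k x) / k\<close>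
  with \<open>k = sqrt \<sigma>\<close>. With \<open>t = k L / 2\<close> the conditions at \<open>L\<close> become \<open>sin t (sin t - t cos t) = 0\<close>.
  The positive roots, listed increasingly as \<open>\<tau>\<^sub>2 < \<tau>\<^sub>3 < \<dots>\<close>, satisfy \<open>\<tau>\<^sub>n\<^sup>2 = (n \<pi> / 2)\<^sup>2 + O(1)\<close>, because
  the root of \<open>tan t = t\<close> below \<open>m = (j + 1/2) \<pi>\<close> has distance \<open>O(1 / m)\<close> from \<open>m\<close>. So the eigenvalues are
  those of the Dirichlet Laplacian, without the first one, up to \<open>O(1)\<close>. As there are
  \<open>O(sqrt z)\<close> of them below \<open>z\<close>, the perturbation costs \<open>O(sqrt z)\<close>, the Dirichlet Riesz mean has second
  term \<open>- z / 2\<close>, and the missing first eigenvalue contributes another \<open>- z\<close>.\<close>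

section \<open>Integration against a primitive\<close>

lemma integral_by_parts_primitive:
  fixes f f' g :: "real \<Rightarrow> real"
  assumes "a \<le> b" and g: "g absolutely_integrable_on {a..b}"
    and df: "\<And>x. x \<in> {a..b} \<Longrightarrow> (f has_real_derivative f' x) (at x within {a..b})"
    and cf': "continuous_on {a..b} f'"
  shows "integral {a..b} (\<lambda>x. f x * g x)
           = f b * integral {a..b} g - integral {a..b} (\<lambda>x. f' x * integral {a..x} g)"
proof -
  have cf: "continuous_on {a..b} f"
    by (rule DERIV_continuous_on[OF df])
  have gi: "g integrable_on {a..b}" and gai: "(\<lambda>x. \<bar>g x\<bar>) integrable_on {a..b}"
    using g by (auto simp: absolutely_integrable_on_def)
  have sub: "{p..q} \<subseteq> {a..b}" if "a \<le> p" "q \<le> b" for p q using that by auto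
  have giS: "g integrable_on {p..q}" "(\<lambda>x. \<bar>g x\<bar>) integrable_on {p..q}" if "a \<le> p" "q \<le> b" for p q
    using integrable_subinterval_real[OF gi sub[OF that]] integrable_subinterval_real[OF gai sub[OF that]]
    by auto
  define G where "G \<equiv> \<lambda>x. integral {a..x} g"
  define A where "A \<equiv> \<lambda>x. integral {a..x} (\<lambda>x. \<bar>g x\<bar>)"
  have cG: "continuous_on {a..b} G" unfolding G_def by (rule indefinite_integral_continuous_1[OF gi])
  have cA: "continuous_on {a..b} A" unfolding A_def by (rule indefinite_integral_continuous_1[OF gai])
  have fg: "(\<lambda>x. f x * g x) integrable_on {a..b}"
  proof -
    have "(\<lambda>x. f x * g x) absolutely_integrable_on {a..b}"
      by (intro absolutely_integrable_bounded_measurable_product_real g compact_imp_bounded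
          compact_continuous_image cf continuous_imp_measurable_on_sets_lebesgue) auto
    then show ?thesis by (simp add: absolutely_integrable_on_def)
  qed
  have cf'G: "continuous_on {a..b} (\<lambda>x. f' x * G x)" by (intro continuous_intros cf' cG)
  then have f'G: "(\<lambda>x. f' x * G x) integrable_on {a..b}"
    by (rule integrable_continuous_real)
  have fgS: "(\<lambda>x. f x * g x) integrable_on {p..q}" "(\<lambda>x. f' x * G x) integrable_on {p..q}"
     if "a \<le> p" "q \<le> b" for p q
    using integrable_subinterval_real[OF fg sub[OF that]] integrable_subinterval_real[OF f'G sub[OF that]]
    by auto
  have "bounded (f' ` {a..b})"
    by (intro compact_imp_bounded compact_continuous_image cf') auto
  then obtain C where "C > 0" and "\<forall>y\<in>f' ` {a..b}. norm y \<le> C"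
    unfolding bounded_pos by blast
  then have C: "\<And>x. x \<in> {a..b} \<Longrightarrow> \<bar>f' x\<bar> \<le> C" by auto
  define H where "H \<equiv> \<lambda>x. integral {a..x} (\<lambda>x. f x * g x) - f x * G x + integral {a..x} (\<lambda>x. f' x * G x)"
  have lip: "\<bar>f y - f x\<bar> \<le> C * \<bar>y - x\<bar>" if "x \<in> {a..b}" "y \<in> {a..b}" for x y
    using field_differentiable_bound[of "{a..b}" f f' C y x] df C that by auto
  have key: "\<bar>H y - H x\<bar> \<le> 2 * C * (y - x) * \<bar>A y - A x\<bar>" if xy: "a \<le> x" "x \<le> y" "y \<le> b" for x y
  proof -
    have comb: "integral {a..y} h = integral {a..x} h + integral {x..y} h" 
      if "h integrable_on {a..b}" for h :: "real \<Rightarrow> real"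
      using Henstock_Kurzweil_Integration.integral_combine[OF xy(1,2) integrable_subinterval_real[OF that sub]] xy by auto
    have Axy: "A y - A x = integral {x..y} (\<lambda>x. \<bar>g x\<bar>)"
      unfolding A_def using comb[OF gai] by simp
    have Gxy: "G y - G x = integral {x..y} g"
      unfolding G_def using comb[OF gi] by simp
    have "H y - H x = integral {x..y} (\<lambda>x. f x * g x) - (f y * G y - f x * G x) + integral {x..y} (\<lambda>x. f' x * G x)"
      unfolding H_def using comb[OF fg] comb[OF f'G] by simp
    \<comment> \<open>\<open>f\<close> is frozen at the right end and \<open>G\<close> at the left
      end. The remainders are then the integrals of \<open>(f t - f y) * g t\<close> and
      \<open>f' t * (G t - G x)\<close>, each bounded by
      \<open>C * (y - x) * (A y - A x)\<close>.\<close>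
    also have "f y * G y - f x * G x = f y * integral {x..y} g + G x * integral {x..y} f'"
    proof -
      have f'_eq: "integral {x..y} f' = f y - f x"
        using xy by (intro integral_unique fundamental_theorem_of_calculus)
          (auto simp flip: has_real_derivative_iff_has_vector_derivative intro!: DERIV_subset[OF df])
      show ?thesis unfolding f'_eq Gxy[symmetric] by (simp add: algebra_simps)
    qed
    also have "f y * integral {x..y} g = integral {x..y} (\<lambda>t. f y * g t)" by simp
    also have "G x * integral {x..y} f' = integral {x..y} (\<lambda>t. G x * f' t)" by simp
    finally have "H y - H x = (integral {x..y} (\<lambda>t. f t * g t) - integral {x..y} (\<lambda>t. f y * g t))
         + (integral {x..y} (\<lambda>t. f' t * G t) - integral {x..y} (\<lambda>t. G x * f' t))" by simp
    also have "integral {x..y} (\<lambda>t. f t * g t) - integral {x..y} (\<lambda>t. f y * g t)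
       = integral {x..y} (\<lambda>t. f t * g t - f y * g t)"
      using xy giS by (intro Henstock_Kurzweil_Integration.integral_diff[symmetric] fgS integrable_on_mult_right) auto
    also have "integral {x..y} (\<lambda>t. f' t * G t) - integral {x..y} (\<lambda>t. G x * f' t) 
       = integral {x..y} (\<lambda>t. f' t * G t - G x * f' t)"
      using xy by (intro Henstock_Kurzweil_Integration.integral_diff[symmetric] fgS integrable_on_mult_right
         integrable_subinterval_real[OF integrable_continuous_real[OF cf']]) auto
    finally have eq: "H y - H x = integral {x..y} (\<lambda>t. f t * g t - f y * g t) 
        + integral {x..y} (\<lambda>t. f' t * G t - G x * f' t)" .
    have "norm (integral {x..y} (\<lambda>t. f t * g t - f y * g t)) \<le> integral {x..y} (\<lambda>t. C * (y - x) * \<bar>g t\<bar>)"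
    proof (rule integral_norm_bound_integral)
      show "(\<lambda>t. f t * g t - f y * g t) integrable_on {x..y}"
        using xy giS by (intro Henstock_Kurzweil_Integration.integrable_diff fgS integrable_on_mult_right) auto
      show "(\<lambda>t. C * (y - x) * \<bar>g t\<bar>) integrable_on {x..y}"
        using xy giS by (intro integrable_on_mult_right) auto
      fix t assume t: "t \<in> {x..y}"
      have "\<bar>f t - f y\<bar> \<le> C * \<bar>t - y\<bar>" using lip[of y t] t xy by auto
      also have "\<dots> \<le> C * (y - x)" using t \<open>C > 0\<close> by (intro mult_left_mono) auto
      finally show "norm (f t * g t - f y * g t) \<le> C * (y - x) * \<bar>g t\<bar>"
        by (simp flip: left_diff_distrib add: abs_mult mult_right_mono)
    qed
    also have "\<dots> = C * (y - x) * (A y - A x)" by (simp add: Axy)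
    finally have 1: "\<bar>integral {x..y} (\<lambda>t. f t * g t - f y * g t)\<bar> \<le> C * (y - x) * (A y - A x)" by simp
    have "norm (integral {x..y} (\<lambda>t. f' t * G t - G x * f' t)) \<le> integral {x..y} (\<lambda>t. C * (A y - A x))"
    proof (rule integral_norm_bound_integral)
      show "(\<lambda>t. f' t * G t - G x * f' t) integrable_on {x..y}"
        using xy by (intro Henstock_Kurzweil_Integration.integrable_diff fgS integrable_on_mult_right
          integrable_subinterval_real[OF integrable_continuous_real[OF cf']]) auto
      fix t assume t: "t \<in> {x..y}"
      have "G t - G x = integral {x..t} g"
        unfolding G_def using Henstock_Kurzweil_Integration.integral_combine[of a x t g] giS[of a t] t xy by auto
      then have "\<bar>G t - G x\<bar> = norm (integral {x..t} g)" by simp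
      also have "\<dots> \<le> integral {x..t} (\<lambda>x. \<bar>g x\<bar>)"
        using t xy by (intro integral_norm_bound_integral giS) auto
      also have "\<dots> \<le> integral {x..y} (\<lambda>x. \<bar>g x\<bar>)"
        using t xy by (intro integral_subset_le giS) auto
      finally have "\<bar>G t - G x\<bar> \<le> A y - A x" using Axy by simp
      then have "\<bar>f' t\<bar> * \<bar>G t - G x\<bar> \<le> C * (A y - A x)"
        using C[of t] t xy \<open>C > 0\<close> by (intro mult_mono) auto
      moreover have "f' t * G t - G x * f' t = f' t * (G t - G x)" by (simp add: algebra_simps)
      ultimately show "norm (f' t * G t - G x * f' t) \<le> C * (A y - A x)"
        by (simp add: abs_mult)
    qed auto
    also have "\<dots> = C * (y - x) * (A y - A x)" using xy by (simp add: algebra_simps)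
    finally have 2: "\<bar>integral {x..y} (\<lambda>t. f' t * G t - G x * f' t)\<bar> \<le> C * (y - x) * (A y - A x)" by simp
    have "C * (y - x) * (A y - A x) \<le> C * (y - x) * \<bar>A y - A x\<bar>"
      using \<open>C > 0\<close> xy by (intro mult_left_mono) auto
    with eq 1 2 show ?thesis by (simp add: algebra_simps)
  qed
  have "\<exists>c. \<forall>x\<in>{a..b}. H x = c"
  proof (rule has_field_derivative_zero_constant)
    fix x assume x: "x \<in> {a..b}"
    have bd: "\<bar>H y - H x\<bar> \<le> 2 * C * \<bar>y - x\<bar> * \<bar>A y - A x\<bar>" if "y \<in> {a..b}" for y
    proof (cases "x \<le> y")
      case True
      then show ?thesis using key[of x y] x that by auto
    next
      case False
      then show ?thesis using key[of y x] x that by (auto simp: abs_minus_commute)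
    qed
    have "((\<lambda>y. (H y - H x) / (y - x)) \<longlongrightarrow> 0) (at x within {a..b})"
    proof (rule Lim_null_comparison)
      show "\<forall>\<^sub>F y in at x within {a..b}. norm ((H y - H x) / (y - x)) \<le> 2 * C * \<bar>A y - A x\<bar>"
        unfolding eventually_at_filter
        using bd by (intro always_eventually) (auto simp: divide_simps mult_ac)
      have "(A \<longlongrightarrow> A x) (at x within {a..b})" using cA x by (auto simp: continuous_on_def)
      then have "((\<lambda>y. 2 * C * \<bar>A y - A x\<bar>) \<longlongrightarrow> 2 * C * \<bar>A x - A x\<bar>) (at x within {a..b})"
        by (intro tendsto_intros)
      then show "((\<lambda>y. 2 * C * \<bar>A y - A x\<bar>) \<longlongrightarrow> 0) (at x within {a..b})" by simp
    qed
    then show "(H has_field_derivative 0) (at x within {a..b})"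
      by (simp add: has_field_derivative_iff)
  qed auto
  then have "H b = H a" using \<open>a \<le> b\<close> by auto
  then show ?thesis by (simp add: H_def G_def)
qed

text \<open>\<open>h\<close> may be nonzero on a null set, so the conclusion concerns its primitive.
  The pointwise bound of \<open>\<bar>h t\<bar>\<close> by \<open>c + (h t)\<^sup>2 / c\<close>
  bounds the primitive by \<open>c * (x - a)\<close> for every \<open>c > 0\<close>.\<close>

lemma square_integral_zero_imp_primitive_zero:
  fixes h :: "real \<Rightarrow> real"
  assumes h: "h integrable_on {a..b}" and h2: "(\<lambda>x. (h x)\<^sup>2) integrable_on {a..b}"
    and 0: "integral {a..b} (\<lambda>x. (h x)\<^sup>2) = 0" and x: "x \<in> {a..b}"
  shows "integral {a..x} h = 0"
proof -
  have sub: "{a..x} \<subseteq> {a..b}" using x by auto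
  have ix: "h integrable_on {a..x}" "(\<lambda>x. (h x)\<^sup>2) integrable_on {a..x}"
    using integrable_subinterval_real[OF h sub] integrable_subinterval_real[OF h2 sub] by auto
  have "integral {a..x} (\<lambda>x. (h x)\<^sup>2) \<le> 0"
    using integral_subset_le[OF sub ix(2) h2] 0 by simp
  then have 0: "integral {a..x} (\<lambda>x. (h x)\<^sup>2) = 0"
    using integral_nonneg[OF ix(2)] by simp
  have *: "\<bar>integral {a..x} h\<bar> \<le> c * (x - a)" if "c > 0" for c
  proof -
    have "norm (integral {a..x} h) \<le> integral {a..x} (\<lambda>t. c + (1 / c) * (h t)\<^sup>2)"
    proof (rule integral_norm_bound_integral)
      show "(\<lambda>t. c + (1 / c) * (h t)\<^sup>2) integrable_on {a..x}"
        by (intro Henstock_Kurzweil_Integration.integrable_add integrable_on_mult_right ix) auto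
      fix t
      have "0 \<le> (c - \<bar>h t\<bar>)\<^sup>2 + c * \<bar>h t\<bar>" using that by simp
      then have "c * \<bar>h t\<bar> \<le> c\<^sup>2 + (h t)\<^sup>2" by (simp add: power2_eq_square algebra_simps)
      then show "norm (h t) \<le> c + (1 / c) * (h t)\<^sup>2"
        using that by (simp add: field_simps power2_eq_square)
    qed (rule ix)
    also have "\<dots> = c * (x - a) + (1 / c) * integral {a..x} (\<lambda>t. (h t)\<^sup>2)"
      using x by (subst Henstock_Kurzweil_Integration.integral_add)
        (auto intro!: integrable_on_mult_right integrable_on_divide ix)
    finally show ?thesis using 0 by simp
  qed
  have "\<bar>integral {a..x} h\<bar> \<le> 0"
  proof (rule field_le_epsilon)
    fix e :: real assume e: "e > 0"
    have "e / (x - a + 1) * (x - a) \<le> e" using e x by (simp add: field_simps)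
    then show "\<bar>integral {a..x} h\<bar> \<le> 0 + e" using *[of "e / (x - a + 1)"] e x by auto
  qed
  then show ?thesis by simp
qed

section \<open>Weak solutions\<close>

lemma absolutely_integrable_mult_of_square_integrable:
  fixes f g :: "real \<Rightarrow> real"
  assumes "f absolutely_integrable_on {a..b}" "g absolutely_integrable_on {a..b}"
    and "(\<lambda>x. (f x)\<^sup>2) integrable_on {a..b}" "(\<lambda>x. (g x)\<^sup>2) integrable_on {a..b}"
  shows "(\<lambda>x. f x * g x) absolutely_integrable_on {a..b}"
proof (rule measurable_bounded_by_integrable_imp_absolutely_integrable)
  show "(\<lambda>x. f x * g x) \<in> borel_measurable (lebesgue_on {a..b})"
    by (intro borel_measurable_times absolutely_integrable_imp_borel_measurable assms) auto
  show "(\<lambda>x. (f x)\<^sup>2 + (g x)\<^sup>2) integrable_on {a..b}"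
    by (intro Henstock_Kurzweil_Integration.integrable_add assms)
  fix x
  have "0 \<le> (\<bar>f x\<bar> - \<bar>g x\<bar>)\<^sup>2 + \<bar>f x\<bar> * \<bar>g x\<bar>" by simp
  then show "norm (f x * g x) \<le> (f x)\<^sup>2 + (g x)\<^sup>2"
    by (simp add: power2_eq_square algebra_simps abs_mult)
qed auto

lemma square_integrable_add:
  fixes f g :: "real \<Rightarrow> real"
  assumes "f absolutely_integrable_on {a..b}" "g absolutely_integrable_on {a..b}"
    and "(\<lambda>x. (f x)\<^sup>2) integrable_on {a..b}" "(\<lambda>x. (g x)\<^sup>2) integrable_on {a..b}"
  shows "(\<lambda>x. (f x + g x)\<^sup>2) integrable_on {a..b}"
proof -
  have "(\<lambda>x. f x * g x) integrable_on {a..b}"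
    using absolutely_integrable_mult_of_square_integrable[OF assms]
    by (simp add: absolutely_integrable_on_def)
  then have "(\<lambda>x. (f x)\<^sup>2 + (g x)\<^sup>2 + 2 * (f x * g x)) integrable_on {a..b}"
    by (intro Henstock_Kurzweil_Integration.integrable_add assms integrable_on_mult_right)
  then show ?thesis by (simp add: power2_sum mult.assoc)
qed

section \<open>Boundary values, derivatives and integration by parts in \<open>H2_0\<close>\<close>

context
  fixes L :: real and u u1 u2 :: "real \<Rightarrow> real"
  assumes L: "L > 0" and H: "H2_0 L u u1 u2"
begin

lemma H2_0_abs_int: "u2 absolutely_integrable_on {0..L}"
  and H2_0_int: "u2 integrable_on {0..L}"
  and H2_0_sq_int: "(\<lambda>x. (u2 x)\<^sup>2) integrable_on {0..L}"
  and H2_0_u1: "x \<in> {0..L} \<Longrightarrow> u1 x = integral {0..x} u2"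
  and H2_0_u: "x \<in> {0..L} \<Longrightarrow> u x = integral {0..x} u1"
  and H2_0_end: "u1 L = 0" "u L = 0"
  using H by (auto simp: H2_0_def absolutely_integrable_on_def)

lemma H2_0_start: "u1 0 = 0" "u 0 = 0"
  using H2_0_u1[of 0] H2_0_u[of 0] L by auto

lemma H2_0_cont1: "continuous_on {0..L} u1"
  by (rule continuous_on_eq[OF indefinite_integral_continuous_1[OF H2_0_int]]) (simp add: H2_0_u1)

lemma H2_0_deriv:
  assumes "x \<in> {0..L}"
  shows "(u has_real_derivative u1 x) (at x within {0..L})"
  by (rule has_field_derivative_transform_within[OF integral_has_real_derivative[OF H2_0_cont1 assms] zero_less_one assms])
     (simp add: H2_0_u)

lemma H2_0_cont: "continuous_on {0..L} u"
  by (rule DERIV_continuous_on[OF H2_0_deriv])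

text \<open>The boundary terms vanish because \<open>u1\<close> is zero at both ends. The factor
  \<open>f\<close> will be a weak solution, an affine function, or the second derivative of a
  classical solution.\<close>

lemma integral_times_second_derivative:
  assumes df: "\<And>x. x \<in> {0..L} \<Longrightarrow> (f has_real_derivative f' x) (at x within {0..L})"
    and cf': "continuous_on {0..L} f'"
  shows "integral {0..L} (\<lambda>x. f x * u2 x) = - integral {0..L} (\<lambda>x. f' x * u1 x)"
proof -
  have "integral {0..L} (\<lambda>x. f x * u2 x)
     = f L * integral {0..L} u2 - integral {0..L} (\<lambda>x. f' x * integral {0..x} u2)"
    using L by (intro integral_by_parts_primitive H2_0_abs_int df cf') auto
  also have "integral {0..L} u2 = 0" using H2_0_u1[of L] H2_0_end L by simp
  also have "integral {0..L} (\<lambda>x. f' x * integral {0..x} u2) = integral {0..L} (\<lambda>x. f' x * u1 x)"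
    by (intro integral_cong) (simp add: H2_0_u1)
  finally show ?thesis by simp
qed

end

lemma H2_0_intro:
  assumes u: "\<And>x. x \<in> {0..L} \<Longrightarrow> (u has_real_derivative u1 x) (at x within {0..L})"
    and u1: "\<And>x. x \<in> {0..L} \<Longrightarrow> (u1 has_real_derivative u2 x) (at x within {0..L})"
    and u2: "continuous_on {0..L} u2"
    and bc: "u 0 = 0" "u1 0 = 0" "u L = 0" "u1 L = 0"
  shows "H2_0 L u u1 u2"
proof -
  have "integral {0..x} f' = f x - f 0"
    if "x \<in> {0..L}" "\<And>x. x \<in> {0..L} \<Longrightarrow> (f has_real_derivative f' x) (at x within {0..L})" for f f' x
    using that(1)
    by (intro integral_unique fundamental_theorem_of_calculus)
       (auto simp flip: has_real_derivative_iff_has_vector_derivative intro!: DERIV_subset[OF that(2)])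
  from this[OF _ u] this[OF _ u1] bc show ?thesis
    unfolding H2_0_def
    by (auto intro!: absolutely_integrable_continuous_real u2 integrable_continuous_real continuous_intros)
qed

text \<open>Testing the weak equation with \<open>u\<close> itself gives the Rayleigh identity. For
  \<open>\<sigma> \<le> 0\<close> it forces the integral of \<open>u2\<close> squared to vanish,
  hence \<open>u1 = 0\<close> and \<open>u = 0\<close> on the interval.\<close>

lemma buckling_eigenvalue_pos:
  assumes L: "L > 0" and ev: "buckling_eigenvalue L \<sigma>"
  shows "\<sigma> > 0"
proof (rule ccontr)
  assume "\<not> \<sigma> > 0"
  from ev obtain u u1 u2 x where H: "H2_0 L u u1 u2" and x: "x \<in> {0..L}" "u x \<noteq> 0"
    and weak: "\<And>\<phi> \<phi>1 \<phi>2. H2_0 L \<phi> \<phi>1 \<phi>2 \<Longrightarrow>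
       integral {0..L} (\<lambda>x. u2 x * \<phi>2 x) = \<sigma> * integral {0..L} (\<lambda>x. u1 x * \<phi>1 x)"
    unfolding buckling_eigenvalue_def by blast
  have "integral {0..L} (\<lambda>x. (u1 x)\<^sup>2) \<ge> 0"
    by (intro integral_nonneg integrable_continuous_real continuous_intros H2_0_cont1[OF L H]) auto
  then have "integral {0..L} (\<lambda>x. (u2 x)\<^sup>2) \<le> 0"
    using weak[OF H] \<open>\<not> \<sigma> > 0\<close> by (simp add: power2_eq_square mult_nonpos_nonneg)
  moreover have "integral {0..L} (\<lambda>x. (u2 x)\<^sup>2) \<ge> 0"
    by (intro integral_nonneg H2_0_sq_int[OF L H]) auto
  ultimately have "integral {0..L} (\<lambda>x. (u2 x)\<^sup>2) = 0" by simp
  then have "u1 y = 0" if "y \<in> {0..L}" for y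
    using square_integral_zero_imp_primitive_zero[OF H2_0_int[OF L H] H2_0_sq_int[OF L H] _ that]
      H2_0_u1[OF L H that] by simp
  then have "integral {0..x} u1 = integral {0..x} (\<lambda>_. 0)"
    using x by (intro integral_cong) auto
  then show False using H2_0_u[OF L H x(1)] x(2) by simp
qed

text \<open>The test function is the double primitive of the component of \<open>u'' + \<sigma> u\<close> orthogonal to the affine
  functions, which is admissible because \<open>\<phi>'' = p\<close> is solvable in \<open>H\<^sup>2\<^sub>0\<close> iff \<open>p\<close> is orthogonal to \<open>1\<close> and \<open>x\<close>.\<close>
lemma weak_solution_second_derivative_affine:
  assumes L: "L > 0" and H: "H2_0 L u u1 u2"
    and weak: "\<And>\<phi> \<phi>1 \<phi>2. H2_0 L \<phi> \<phi>1 \<phi>2 \<Longrightarrow>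
       integral {0..L} (\<lambda>x. u2 x * \<phi>2 x) = \<sigma> * integral {0..L} (\<lambda>x. u1 x * \<phi>1 x)"
  obtains a b where "\<And>x. x \<in> {0..L} \<Longrightarrow>
    (u1 has_real_derivative (a + b * x - \<sigma> * u x)) (at x within {0..L})"
proof -
  define w where "w \<equiv> \<lambda>x. u2 x + \<sigma> * u x"
  note cu = H2_0_cont[OF L H]
  have csu: "continuous_on {0..L} (\<lambda>x. \<sigma> * u x)" by (intro continuous_intros cu)
  have wa: "w absolutely_integrable_on {0..L}"
    unfolding w_def by (intro set_integral_add H2_0_abs_int[OF L H] absolutely_integrable_continuous_real csu)
  have w2: "(\<lambda>x. (w x)\<^sup>2) integrable_on {0..L}"
    unfolding w_def
    by (intro square_integrable_add H2_0_abs_int[OF L H] H2_0_sq_int[OF L H]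
        absolutely_integrable_continuous_real csu integrable_continuous_real continuous_intros cu)
  have wi: "w integrable_on {0..L}" using wa by (simp add: absolutely_integrable_on_def)
  define P where "P = integral {0..L} w"
  define Q where "Q = integral {0..L} (\<lambda>x. integral {0..x} w)"
  \<comment> \<open>\<open>a\<close> and \<open>b\<close> solve
    \<open>P = a * L + b * L^2 / 2\<close> and \<open>Q = a * L^2 / 2 + b * L^3 / 6\<close>, which
    say that \<open>p1\<close> and \<open>p0\<close> vanish at \<open>L\<close>.\<close>
  define b where "b = (P * L / 2 - Q) * 12 / L ^ 3"
  define a where "a = P / L - b * L / 2"
  define q where "q \<equiv> \<lambda>x. - a - b * x"
  define p where "p \<equiv> \<lambda>x. w x + q x"
  define p1 where "p1 \<equiv> \<lambda>x. integral {0..x} p"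
  define p0 where "p0 \<equiv> \<lambda>x. integral {0..x} p1"
  have cq: "continuous_on A q" for A unfolding q_def by (intro continuous_intros)
  have qa: "q absolutely_integrable_on {0..L}" by (intro absolutely_integrable_continuous_real cq)
  have q2: "(\<lambda>x. (q x)\<^sup>2) integrable_on {0..L}" 
    by (intro integrable_continuous_real continuous_intros cq)
  have pa: "p absolutely_integrable_on {0..L}"
    unfolding p_def by (intro set_integral_add wa qa)
  have p2: "(\<lambda>x. (p x)\<^sup>2) integrable_on {0..L}"
    unfolding p_def by (intro square_integrable_add wa w2 qa q2)
  have intq: "integral {0..x} q = - a * x - b * x\<^sup>2 / 2" if "x \<ge> 0" for x
  proof -
    have "(q has_integral ((- a * x - b * x\<^sup>2 / 2) - (- a * 0 - b * 0\<^sup>2 / 2))) {0..x}"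
      unfolding q_def using that
      by (intro fundamental_theorem_of_calculus)
         (auto simp flip: has_real_derivative_iff_has_vector_derivative intro!: derivative_eq_intros)
    then show ?thesis by (simp add: integral_unique)
  qed
  have p1_eq: "p1 x = integral {0..x} w + (- a * x - b * x\<^sup>2 / 2)" if "x \<in> {0..L}" for x
    unfolding p1_def p_def using that intq[of x]
    by (subst Henstock_Kurzweil_Integration.integral_add)
       (auto intro!: integrable_continuous_real cq integrable_subinterval_real[OF wi])
  have p1L: "p1 L = 0"
    using p1_eq[of L] L by (simp add: a_def P_def[symmetric] field_simps power2_eq_square)
  have p0L: "p0 L = 0"
  proof -
    have "p0 L = integral {0..L} (\<lambda>x. integral {0..x} w + (- a * x - b * x\<^sup>2 / 2))"
      unfolding p0_def by (intro integral_cong p1_eq)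
    also have "\<dots> = Q + integral {0..L} (\<lambda>x. - a * x - b * x\<^sup>2 / 2)"
      unfolding Q_def
      by (intro Henstock_Kurzweil_Integration.integral_add integrable_continuous_real
        indefinite_integral_continuous_1 wi continuous_intros) auto
    also have "integral {0..L} (\<lambda>x. - a * x - b * x\<^sup>2 / 2) = - a * L\<^sup>2 / 2 - b * L ^ 3 / 6"
    proof -
      have "((\<lambda>x. - a * x - b * x\<^sup>2 / 2) has_integral ((- a * L\<^sup>2 / 2 - b * L ^ 3 / 6) - (- a * 0\<^sup>2 / 2 - b * 0 ^ 3 / 6))) {0..L}"
        using L
        by (intro fundamental_theorem_of_calculus)
          (auto simp flip: has_real_derivative_iff_has_vector_derivative intro!: derivative_eq_intros simp: field_simps)
      then show ?thesis by (simp add: integral_unique)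
    qed
    also have "Q + (- a * L\<^sup>2 / 2 - b * L ^ 3 / 6) = 0"
      using L by (simp add: a_def b_def field_simps power2_eq_square power3_eq_cube)
    finally show ?thesis .
  qed
  have Hp: "H2_0 L p0 p1 p"
    using pa p2 p1L p0L by (auto simp: H2_0_def p0_def p1_def)
  \<comment> \<open>The weak equation is tested with \<open>p0\<close>. Integration by parts turns
    the integral of \<open>u x * p x\<close> into minus that of \<open>u1 x * p1 x\<close>, so the
    two contributions cancel.\<close>
  have wp: "integral {0..L} (\<lambda>x. w x * p x) = 0"
  proof -
    have "(\<lambda>x. u2 x * p x) absolutely_integrable_on {0..L}"
      "(\<lambda>x. (\<sigma> * u x) * p x) absolutely_integrable_on {0..L}"
      by (intro absolutely_integrable_mult_of_square_integrable H2_0_abs_int[OF L H] H2_0_sq_int[OF L H] pa p2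
        absolutely_integrable_continuous_real csu integrable_continuous_real continuous_intros cu)+
    then have "integral {0..L} (\<lambda>x. u2 x * p x + (\<sigma> * u x) * p x)
      = integral {0..L} (\<lambda>x. u2 x * p x) + integral {0..L} (\<lambda>x. \<sigma> * (u x * p x))"
      by (subst Henstock_Kurzweil_Integration.integral_add) (auto simp: absolutely_integrable_on_def mult.assoc)
    also have "integral {0..L} (\<lambda>x. \<sigma> * (u x * p x)) = \<sigma> * integral {0..L} (\<lambda>x. u x * p x)" by simp
    also have "integral {0..L} (\<lambda>x. u x * p x) = - integral {0..L} (\<lambda>x. u1 x * p1 x)"
      by (intro integral_times_second_derivative[OF L Hp] H2_0_deriv[OF L H] H2_0_cont1[OF L H])
    finally show ?thesis using weak[OF Hp] by (simp add: w_def algebra_simps)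
  qed
  \<comment> \<open>\<open>q\<close> is affine, and second derivatives of clamped functions are
    orthogonal to affine functions. Together with \<open>wp\<close> this makes \<open>p\<close>
    orthogonal to itself.\<close>
  have qp: "integral {0..L} (\<lambda>x. q x * p x) = 0"
  proof -
    have "integral {0..L} (\<lambda>x. q x * p x) = - integral {0..L} (\<lambda>x. (- b) * p1 x)"
      by (intro integral_times_second_derivative[OF L Hp])
         (auto simp: q_def intro!: derivative_eq_intros)
    also have "\<dots> = b * p0 L" by (simp add: p0_def)
    finally show ?thesis using p0L by simp
  qed
  have "integral {0..L} (\<lambda>x. (p x)\<^sup>2) = integral {0..L} (\<lambda>x. w x * p x + q x * p x)"
    by (simp add: p_def power2_eq_square algebra_simps)
  also have "\<dots> = integral {0..L} (\<lambda>x. w x * p x) + integral {0..L} (\<lambda>x. q x * p x)"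
    using absolutely_integrable_mult_of_square_integrable[OF wa pa w2 p2]
      absolutely_integrable_mult_of_square_integrable[OF qa pa q2 p2]
    by (intro Henstock_Kurzweil_Integration.integral_add) (auto simp: absolutely_integrable_on_def)
  finally have "integral {0..L} (\<lambda>x. (p x)\<^sup>2) = 0" using wp qp by simp
  then have p1z: "p1 x = 0" if "x \<in> {0..L}" for x
    unfolding p1_def using square_integral_zero_imp_primitive_zero[OF _ p2 _ that] pa
    by (simp add: absolutely_integrable_on_def)
  \<comment> \<open>\<open>v\<close> is the continuous representative of \<open>u2\<close>:
    pointwise \<open>u2 = p + v\<close>, and \<open>p\<close> has zero primitive, so
    \<open>u1\<close> is the primitive of a continuous function and is differentiable
    everywhere.\<close>
  define v where "v \<equiv> \<lambda>x. a + b * x - \<sigma> * u x"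
  have cv: "continuous_on {0..L} v" unfolding v_def by (intro continuous_intros cu)
  have u1v: "u1 x = integral {0..x} v" if x: "x \<in> {0..L}" for x
  proof -
    have "u1 x = integral {0..x} (\<lambda>t. p t + v t)"
      using H2_0_u1[OF L H x] by (simp add: p_def w_def q_def v_def)
    also have "\<dots> = p1 x + integral {0..x} v"
    proof -
      have "{0..x} \<subseteq> {0..L}" using x by auto
      then have "p integrable_on {0..x}" "v integrable_on {0..x}"
        using pa integrable_subinterval_real[of _ 0 L 0 x] integrable_continuous_real[OF cv]
        by (auto simp: absolutely_integrable_on_def)
      then show ?thesis unfolding p1_def by (rule Henstock_Kurzweil_Integration.integral_add)
    qed
    finally show ?thesis using p1z[OF x] by simp
  qed
  show thesis
  proof (rule that[of a b])
    fix x assume x: "x \<in> {0..L}"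
    show "(u1 has_real_derivative (a + b * x - \<sigma> * u x)) (at x within {0..L})"
      using has_field_derivative_transform_within[OF integral_has_real_derivative[OF cv x] zero_less_one x, of u1] u1v
      by (simp add: v_def)
  qed
qed

section \<open>The characteristic equation\<close>

text \<open>The energy \<open>(v1 x)\<^sup>2 + \<sigma> * (v x)\<^sup>2\<close> is conserved and
  vanishes at 0. This is the uniqueness that identifies an eigenfunction with a
  \<open>clamped\<close> function.\<close>

lemma oscillator_zero:
  fixes v v1 :: "real \<Rightarrow> real"
  assumes \<sigma>: "\<sigma> > 0"
    and v: "\<And>x. x \<in> {0..L} \<Longrightarrow> (v has_real_derivative v1 x) (at x within {0..L})"
    and v1: "\<And>x. x \<in> {0..L} \<Longrightarrow> (v1 has_real_derivative (- \<sigma> * v x)) (at x within {0..L})"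
    and init: "v 0 = 0" "v1 0 = 0" and x: "x \<in> {0..L}"
  shows "v x = 0" "v1 x = 0"
proof -
  have "\<exists>c. \<forall>x\<in>{0..L}. (v1 x)\<^sup>2 + \<sigma> * (v x)\<^sup>2 = c"
    by (rule has_field_derivative_zero_constant) (auto intro!: derivative_eq_intros v v1)
  then have "(v1 x)\<^sup>2 + \<sigma> * (v x)\<^sup>2 = (v1 0)\<^sup>2 + \<sigma> * (v 0)\<^sup>2"
    using x by auto
  then have "(v1 x)\<^sup>2 + \<sigma> * (v x)\<^sup>2 = 0" using init by simp
  then show "v x = 0" "v1 x = 0"
    using \<sigma> by (simp_all add: add_nonneg_eq_0_iff)
qed

lemma sin_less_self:
  fixes x :: real
  assumes "x > 0"
  shows "sin x < x"
proof (cases "x > 1")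
  case True
  then show ?thesis using sin_le_one[of x] by linarith
next
  case False
  have "0 - sin 0 < x - sin x"
  proof (rule DERIV_pos_imp_increasing_open[OF assms])
    fix t assume "0 < t" "t < x"
    then have "cos t < 1" using cos_monotone_0_pi[of 0 t] False pi_gt3 by simp
    moreover have "((\<lambda>x. x - sin x) has_real_derivative 1 - cos t) (at t)"
      by (auto intro!: derivative_eq_intros)
    ultimately show "\<exists>d. ((\<lambda>x. x - sin x) has_real_derivative d) (at t) \<and> 0 < d"
      by (auto intro!: exI[of _ "1 - cos t"])
  qed (intro continuous_intros)
  then show ?thesis by simp
qed

text \<open>For nonzero \<open>k\<close> this is the solution of
  \<open>u'' + k^2 * u = k^2 * (\<alpha> + \<beta> * x)\<close> with
  \<open>u(0) = u'(0) = 0\<close>. The primed versions below are its first and second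
  derivatives.\<close>

definition clamped :: "real \<Rightarrow> real \<Rightarrow> real \<Rightarrow> real \<Rightarrow> real" where
  "clamped k \<alpha> \<beta> x = \<alpha> * (1 - cos (k * x)) + \<beta> * (x - sin (k * x) / k)"

definition clamped' :: "real \<Rightarrow> real \<Rightarrow> real \<Rightarrow> real \<Rightarrow> real" where
  "clamped' k \<alpha> \<beta> x = \<alpha> * k * sin (k * x) + \<beta> * (1 - cos (k * x))"

definition clamped'' :: "real \<Rightarrow> real \<Rightarrow> real \<Rightarrow> real \<Rightarrow> real" where
  "clamped'' k \<alpha> \<beta> x = \<alpha> * k\<^sup>2 * cos (k * x) + \<beta> * k * sin (k * x)"

lemma clamped_deriv: "k \<noteq> 0 \<Longrightarrow> (clamped k \<alpha> \<beta> has_real_derivative clamped' k \<alpha> \<beta> x) (at x within S)"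
  unfolding clamped_def[abs_def] clamped'_def
  by (auto intro!: derivative_eq_intros simp: field_simps)

lemma clamped'_deriv: "(clamped' k \<alpha> \<beta> has_real_derivative clamped'' k \<alpha> \<beta> x) (at x within S)"
  unfolding clamped'_def[abs_def] clamped''_def
  by (auto intro!: derivative_eq_intros simp: algebra_simps power2_eq_square)

lemma clamped_start [simp]: "clamped k \<alpha> \<beta> 0 = 0" "clamped' k \<alpha> \<beta> 0 = 0"
  by (simp_all add: clamped_def clamped'_def)

text \<open>Half-angle form, with \<open>k * L = 2 * t\<close>. The end conditions become a
  homogeneous linear system in \<open>\<alpha>\<close> and \<open>\<beta>\<close> whose determinant
  is \<open>4 * sin t * (sin t - t * cos t)\<close>.\<close>

lemma clamped_end:
  assumes "k \<noteq> 0" "t = k * L / 2"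
  shows "clamped k \<alpha> \<beta> L = 2 * \<alpha> * (sin t)\<^sup>2 + \<beta> * (2 / k) * (t - sin t * cos t)"
    and "clamped' k \<alpha> \<beta> L = 2 * \<alpha> * k * sin t * cos t + 2 * \<beta> * (sin t)\<^sup>2"
proof -
  have kL: "k * L = 2 * t" using assms by simp
  have "L = 2 / k * t" using assms(1) by (simp add: assms(2))
  then have "L - sin (k * L) / k = (2 / k) * (t - sin t * cos t)"
    unfolding kL sin_double using assms(1) by (simp add: field_simps)
  then show "clamped k \<alpha> \<beta> L = 2 * \<alpha> * (sin t)\<^sup>2 + \<beta> * (2 / k) * (t - sin t * cos t)"
    unfolding clamped_def kL cos_double_sin by simp
  show "clamped' k \<alpha> \<beta> L = 2 * \<alpha> * k * sin t * cos t + 2 * \<beta> * (sin t)\<^sup>2"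
    unfolding clamped'_def kL cos_double_sin sin_double by simp
qed

lemma buckling_eigenvalueD:
  assumes L: "L > 0" and ev: "buckling_eigenvalue L \<sigma>"
  defines "t \<equiv> sqrt \<sigma> * L / 2"
  shows "sin t = 0 \<or> sin t = t * cos t"
proof -
  have \<sigma>: "\<sigma> > 0" using buckling_eigenvalue_pos[OF L ev] .
  define k where "k = sqrt \<sigma>"
  have k: "k > 0" "k\<^sup>2 = \<sigma>" and k0: "k \<noteq> 0" using \<sigma> by (auto simp: k_def)
  from ev obtain u u1 u2 x where H: "H2_0 L u u1 u2" and x: "x \<in> {0..L}" "u x \<noteq> 0"
    and weak: "\<And>\<phi> \<phi>1 \<phi>2. H2_0 L \<phi> \<phi>1 \<phi>2 \<Longrightarrow>
       integral {0..L} (\<lambda>x. u2 x * \<phi>2 x) = \<sigma> * integral {0..L} (\<lambda>x. u1 x * \<phi>1 x)"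
    unfolding buckling_eigenvalue_def by blast
  obtain a b where ode: "\<And>x. x \<in> {0..L} \<Longrightarrow>
    (u1 has_real_derivative (a + b * x - \<sigma> * u x)) (at x within {0..L})"
    by (rule weak_solution_second_derivative_affine[OF L H]) (use weak in blast)+
  \<comment> \<open>Dividing by \<open>\<sigma> = k\<^sup>2\<close> matches the right-hand side
    \<open>a + b * x\<close> to the normalisation of \<open>clamped\<close>.\<close>
  define \<alpha> where "\<alpha> = a / \<sigma>"
  define \<beta> where "\<beta> = b / \<sigma>"
  have "u x - clamped k \<alpha> \<beta> x = 0 \<and> u1 x - clamped' k \<alpha> \<beta> x = 0" if "x \<in> {0..L}" for x
  proof -
    have D: "((\<lambda>x. u x - clamped k \<alpha> \<beta> x) has_real_derivative (u1 x - clamped' k \<alpha> \<beta> x)) (at x within {0..L})"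
      if "x \<in> {0..L}" for x
      by (intro DERIV_diff clamped_deriv H2_0_deriv[OF L H] that k0)
    have D': "((\<lambda>x. u1 x - clamped' k \<alpha> \<beta> x) has_real_derivative (- \<sigma> * (u x - clamped k \<alpha> \<beta> x))) (at x within {0..L})"
      if "x \<in> {0..L}" for x
    proof -
      have "a + b * x - \<sigma> * u x - clamped'' k \<alpha> \<beta> x = - \<sigma> * (u x - clamped k \<alpha> \<beta> x)"
        using k0 unfolding clamped_def clamped''_def \<alpha>_def \<beta>_def k(2)[symmetric]
        by (simp add: field_simps power2_eq_square)
      then show ?thesis using DERIV_diff[OF ode[OF that] clamped'_deriv[of k \<alpha> \<beta>]] by (simp only:)
    qed
    show ?thesis
      using oscillator_zero[OF \<sigma> D D' _ _ that] H2_0_start[OF L H] by simp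
  qed
  then have eq: "u x = clamped k \<alpha> \<beta> x" "u1 x = clamped' k \<alpha> \<beta> x" if "x \<in> {0..L}" for x
    using that by auto
  have "\<alpha> \<noteq> 0 \<or> \<beta> \<noteq> 0" using x eq[of x] by (auto simp: clamped_def)
  moreover have t: "t = k * L / 2" by (simp add: t_def k_def)
  have e1: "2 * \<alpha> * (sin t)\<^sup>2 + \<beta> * (2 / k) * (t - sin t * cos t) = 0"
    and e2: "2 * \<alpha> * k * sin t * cos t + 2 * \<beta> * (sin t)\<^sup>2 = 0"
    using eq[of L] H2_0_end[OF L H] clamped_end[OF k0 t, of \<alpha> \<beta>] L by auto
  have e1': "\<alpha> * k * (sin t)\<^sup>2 + \<beta> * (t - sin t * cos t) = 0"
    using e1 k0 by (simp add: field_simps)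
  have e2': "\<alpha> * k * sin t * cos t + \<beta> * (sin t)\<^sup>2 = 0"
    using e2 by simp
  \<comment> \<open>\<open>d\<close> is the determinant of the system \<open>e1'\<close>,
    \<open>e2'\<close> in the unknowns \<open>\<alpha> * k\<close> and \<open>\<beta>\<close>.
    Elimination shows that it annihilates both, and they are not both zero.\<close>
  define d where "d = (sin t)\<^sup>2 * (sin t)\<^sup>2 - sin t * cos t * (t - sin t * cos t)"
  have "\<beta> * d = 0"
    using e1' e2' unfolding d_def by algebra
  moreover have "(\<alpha> * k) * d = 0"
    using e1' e2' unfolding d_def by algebra
  ultimately have "d = 0" using k0 by auto
  moreover have "d = sin t * (sin t * ((sin t)\<^sup>2 + (cos t)\<^sup>2) - t * cos t)"
    unfolding d_def by algebra
  ultimately show ?thesis by auto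
qed

lemma buckling_eigenvalueI:
  assumes L: "L > 0" and \<sigma>: "\<sigma> > 0"
  defines "t \<equiv> sqrt \<sigma> * L / 2"
  assumes char: "sin t = 0 \<or> sin t = t * cos t"
  shows "buckling_eigenvalue L \<sigma>"
proof -
  define k where "k = sqrt \<sigma>"
  have k: "k > 0" "k\<^sup>2 = \<sigma>" and k0: "k \<noteq> 0" using \<sigma> by (auto simp: k_def)
  have t: "t = k * L / 2" by (simp add: t_def k_def)
  \<comment> \<open>This choice satisfies \<open>u L = 0\<close> identically; \<open>u1 L\<close> is
    then a multiple of the determinant. It is nontrivial even where \<open>sin t = 0\<close>, since
    \<open>sin (2 * t) < 2 * t\<close> keeps \<open>\<alpha>\<close> away from zero.\<close>
  define \<alpha> where "\<alpha> = - (t - sin t * cos t)"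
  define \<beta> where "\<beta> = k * (sin t)\<^sup>2"
  have "t > 0" unfolding t using k L by simp
  then have "sin (2 * t) < 2 * t" by (intro sin_less_self) simp
  then have "\<alpha> \<noteq> 0" by (simp add: \<alpha>_def sin_double)
  define u where "u = clamped k \<alpha> \<beta>"
  define u1 where "u1 = clamped' k \<alpha> \<beta>"
  define u2 where "u2 = clamped'' k \<alpha> \<beta>"
  note defs = u_def u1_def u2_def
  have du: "(u has_real_derivative u1 x) (at x within S)" "(u1 has_real_derivative u2 x) (at x within S)" for x S
    unfolding defs by (intro clamped_deriv clamped'_deriv k0)+
  have cu2: "continuous_on S u2" for S unfolding defs clamped''_def[abs_def] by (intro continuous_intros)
  have "sin t * (sin t * ((sin t)\<^sup>2 + (cos t)\<^sup>2) - t * cos t) = 0" using char by auto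
  then have "(sin t)\<^sup>2 * (sin t)\<^sup>2 - sin t * cos t * (t - sin t * cos t) = 0"
    by algebra
  moreover have "u1 L = 2 * k * ((sin t)\<^sup>2 * (sin t)\<^sup>2 - sin t * cos t * (t - sin t * cos t))"
    unfolding defs clamped_end(2)[OF k0 t] by (simp add: \<alpha>_def \<beta>_def algebra_simps)
  moreover have "u L = 0"
    unfolding defs clamped_end(1)[OF k0 t] using k0 by (simp add: \<alpha>_def \<beta>_def algebra_simps)
  ultimately have H: "H2_0 L u u1 u2"
    by (intro H2_0_intro du cu2) (auto simp: defs)
  \<comment> \<open>If \<open>u\<close> vanished on the interval, so would \<open>u2\<close> in the
    interior, and by continuity at 0, where its value is
    \<open>\<alpha> * k\<^sup>2\<close>.\<close>
  have "\<exists>x\<in>{0..L}. u x \<noteq> 0"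
  proof (rule ccontr)
    assume "\<not> ?thesis"
    then have u0: "u x = 0" if "x \<in> {0..L}" for x using that by auto
    have u10: "u1 x = 0" if "x \<in> {0<..<L}" for x
      using has_field_derivative_transform_within_open[of u "u1 x" x "{0<..<L}" "\<lambda>_. 0"] du(1)[of x UNIV] u0 that
      by (auto intro: DERIV_unique)
    have u20: "u2 x = 0" if "x \<in> {0<..<L}" for x
      using has_field_derivative_transform_within_open[of u1 "u2 x" x "{0<..<L}" "\<lambda>_. 0"] du(2)[of x UNIV] u10 that
      by (auto intro: DERIV_unique)
    have "u2 0 = 0"
    proof (rule continuous_constant_on_closure[of "{0<..<L}" u2 0 0])
      show "continuous_on (closure {0<..<L}) u2" by (rule cu2)
    qed (use u20 L in auto)
    then show False using \<open>\<alpha> \<noteq> 0\<close> k0 by (simp add: defs clamped''_def)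
  qed
  moreover have "integral {0..L} (\<lambda>x. u2 x * \<phi>2 x) = \<sigma> * integral {0..L} (\<lambda>x. u1 x * \<phi>1 x)"
    if \<phi>: "H2_0 L \<phi> \<phi>1 \<phi>2" for \<phi> \<phi>1 \<phi>2
  proof -
    \<comment> \<open>This is the equation integrated once. After integration by parts the constant
      \<open>k\<^sup>2 * \<beta>\<close> drops out because \<open>\<phi>1\<close> has integral
      \<open>\<phi> L = 0\<close>.\<close>
    have du2: "(u2 has_real_derivative (k\<^sup>2 * (\<beta> - u1 x))) (at x within S)" for x S
      unfolding defs clamped''_def[abs_def] clamped'_def
      by (auto intro!: derivative_eq_intros simp: algebra_simps power2_eq_square)
    have cu1: "continuous_on S u1" for S by (rule DERIV_continuous_on[OF du(2)])
    have "integral {0..L} (\<lambda>x. u2 x * \<phi>2 x) = - integral {0..L} (\<lambda>x. k\<^sup>2 * (\<beta> - u1 x) * \<phi>1 x)"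
      by (intro integral_times_second_derivative[OF L \<phi>] du2 continuous_intros cu1)
    also have "\<dots> = - integral {0..L} (\<lambda>x. k\<^sup>2 * \<beta> * \<phi>1 x - k\<^sup>2 * (u1 x * \<phi>1 x))"
      by (simp add: algebra_simps)
    also have "\<dots> = - (integral {0..L} (\<lambda>x. k\<^sup>2 * \<beta> * \<phi>1 x) - integral {0..L} (\<lambda>x. k\<^sup>2 * (u1 x * \<phi>1 x)))"
      by (subst Henstock_Kurzweil_Integration.integral_diff)
        (auto intro!: integrable_continuous_real continuous_intros cu1 H2_0_cont1[OF L \<phi>])
    also have "integral {0..L} (\<lambda>x. k\<^sup>2 * \<beta> * \<phi>1 x) = k\<^sup>2 * \<beta> * integral {0..L} \<phi>1" by simp
    also have "integral {0..L} \<phi>1 = 0" using H2_0_u[OF L \<phi>, of L] H2_0_end[OF L \<phi>] L by simp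
    finally show ?thesis by (simp add: k)
  qed
  ultimately show ?thesis unfolding buckling_eigenvalue_def using H by blast
qed

section \<open>Roots of the characteristic equation and their Riesz sum\<close>

lemma sin_cos_add_nat_pi:
  "sin (x + real j * pi) = (-1) ^ j * sin x" "cos (x + real j * pi) = (-1) ^ j * cos x"
proof (induction j)
  case (Suc j)
  have eq: "x + real (Suc j) * pi = (x + real j * pi) + pi" by (simp add: algebra_simps)
  case 1 show ?case unfolding eq sin_periodic_pi using Suc by simp
  case 2 show ?case unfolding eq cos_periodic_pi using Suc by simp
qed auto

text \<open>The derivative is \<open>(t + c) * sin t\<close>. With \<open>c = j * pi\<close> this is
  the equation \<open>tan t = t\<close> translated to \<open>{0..pi}\<close>, so each translate has
  at most one root; \<open>c = 0\<close> excludes roots in \<open>(0, pi)\<close> and gives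
  \<open>x * cos x < sin x\<close> there.\<close>

lemma sin_minus_cos_strict_mono:
  fixes c :: real
  assumes "c \<ge> 0" "0 \<le> x" "x < y" "y \<le> pi"
  shows "sin x - (x + c) * cos x < sin y - (y + c) * cos y"
proof (rule DERIV_pos_imp_increasing_open[OF \<open>x < y\<close>])
  fix t assume t: "x < t" "t < y"
  have "((\<lambda>x. sin x - (x + c) * cos x) has_real_derivative (t + c) * sin t) (at t)"
    by (auto intro!: derivative_eq_intros simp: algebra_simps)
  moreover have "(t + c) * sin t > 0"
    using t assms by (intro mult_pos_pos sin_gt_zero) auto
  ultimately show "\<exists>d. ((\<lambda>x. sin x - (x + c) * cos x) has_real_derivative d) (at t) \<and> 0 < d" by blast
qed (intro continuous_intros)

text \<open>Existence is the intermediate value theorem between the values \<open>- c\<close> at 0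
  and 1 at \<open>pi / 2\<close>. For the distance \<open>d = pi / 2 - x\<close>, the inequality
  \<open>d * cos d < sin d\<close> reads \<open>d * sin x < cos x\<close>; inserting the equation
  and cancelling \<open>cos x > 0\<close> gives the bound.\<close>

lemma shifted_tan_root:
  fixes c :: real
  assumes "c > 0"
  obtains x where "0 < x" "x < pi / 2" "sin x = (x + c) * cos x" "(pi / 2 - x) * (x + c) \<le> 1"
proof -
  let ?g = "\<lambda>x. sin x - (x + c) * cos x"
  have "\<exists>x\<ge>0. x \<le> pi / 2 \<and> ?g x = 0"
    using assms by (intro IVT') (auto intro!: continuous_intros)
  then obtain x where x: "0 \<le> x" "x \<le> pi / 2" "?g x = 0" by blast
  have x': "0 < x" "x < pi / 2"
  proof -
    have "?g (pi / 2) \<noteq> 0" "?g 0 \<noteq> 0" using assms by auto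
    then have "x \<noteq> pi / 2" "x \<noteq> 0" using x(3) by metis+
    then show "0 < x" "x < pi / 2" using x(1,2) by auto
  qed
  define d where "d = pi / 2 - x"
  have d: "0 < d" "d < pi / 2" using x' by (auto simp: d_def)
  then have "d * cos d < sin d" using sin_minus_cos_strict_mono[of 0 0 d] by simp
  then have "d * sin x < cos x" by (simp add: d_def cos_diff sin_diff)
  then have "d * (x + c) * cos x < 1 * cos x" using x by simp
  then have "d * (x + c) \<le> 1"
    using cos_gt_zero[OF x'] by (simp only: mult_less_cancel_right_pos less_imp_le)
  with x x' that show ?thesis by (simp add: d_def)
qed

text \<open>Even indices are the zeros of \<open>sin\<close>, odd ones the solutions of \<open>tan t = t\<close>; index 1 is missing since
  the latter has no solution in \<open>(0, \<pi>)\<close>.\<close>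
lemma enumerate_characteristic_roots:
  obtains \<tau> :: "nat \<Rightarrow> real" where
    "inj_on \<tau> {2..}" "\<tau> ` {2..} = {t. t > 0 \<and> (sin t = 0 \<or> sin t = t * cos t)}"
    "\<forall>n\<ge>2. \<bar>(\<tau> n)\<^sup>2 - (real n * (pi / 2))\<^sup>2\<bar> \<le> 6"
proof -
  have "\<exists>x. 0 < x \<and> x < pi / 2 \<and> sin x = (x + real j * pi) * cos x \<and> (pi / 2 - x) * (x + real j * pi) \<le> 1"
    if "j \<ge> 1" for j
    using shifted_tan_root[of "real j * pi"] that by (metis mult_pos_pos of_nat_0_less_iff pi_gt_zero zero_less_one less_le_trans)
  then obtain r where r: "\<And>j. j \<ge> 1 \<Longrightarrow> 0 < r j" "\<And>j. j \<ge> 1 \<Longrightarrow> r j < pi / 2"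
    "\<And>j. j \<ge> 1 \<Longrightarrow> sin (r j) = (r j + real j * pi) * cos (r j)"
    "\<And>j. j \<ge> 1 \<Longrightarrow> (pi / 2 - r j) * (r j + real j * pi) \<le> 1"
    by metis
  \<comment> \<open>\<open>\<rho> n\<close> is the remainder of the root modulo \<open>pi\<close>:
    \<open>\<tau> (2 * j) = j * pi\<close> and
    \<open>\<tau> (2 * j + 1) = j * pi + r j\<close>.\<close>
  define \<rho> where "\<rho> n = (if even n then 0 else r (n div 2))" for n
  define \<tau> where "\<tau> n = \<rho> n + real (n div 2) * pi" for n
  have \<rho>: "0 \<le> \<rho> n" "\<rho> n < pi" "\<rho> n = 0 \<longleftrightarrow> even n" if "n \<ge> 2" for n
  proof -
    have "n div 2 \<ge> 1" using that by simp
    from r(1,2)[OF this] show "0 \<le> \<rho> n" "\<rho> n < pi" "\<rho> n = 0 \<longleftrightarrow> even n"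
      by (auto simp: \<rho>_def)
  qed
  \<comment> \<open>As remainders lie in \<open>[0, pi)\<close>, the value \<open>\<tau> n\<close>
    determines \<open>n div 2\<close>, and whether the remainder is zero determines the parity of
    \<open>n\<close>.\<close>
  have inj: "inj_on \<tau> {2..}"
  proof (rule inj_onI)
    fix m n assume mn: "m \<in> {2..}" "n \<in> {2..}" "\<tau> m = \<tau> n"
    have eq: "(real (m div 2) - real (n div 2)) * pi = \<rho> n - \<rho> m"
      using mn(3) by (simp add: \<tau>_def algebra_simps)
    have "\<bar>(real (m div 2) - real (n div 2)) * pi\<bar> < 1 * pi"
      unfolding eq using \<rho>[of m] \<rho>[of n] mn by auto
    then have "\<bar>real (m div 2) - real (n div 2)\<bar> < 1"
      by (simp only: abs_mult abs_of_pos pi_gt_zero mult_less_cancel_right_pos)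
    then have div: "m div 2 = n div 2" by linarith
    then have "\<rho> m = \<rho> n" using eq by simp
    then have "even m \<longleftrightarrow> even n" using \<rho>(3)[of m] \<rho>(3)[of n] mn by auto
    with div show "m = n" by (metis even_two_times_div_two odd_two_times_div_two_succ)
  qed
  have char: "\<tau> n > 0 \<and> (sin (\<tau> n) = 0 \<or> sin (\<tau> n) = \<tau> n * cos (\<tau> n))" if n: "n \<ge> 2" for n
  proof -
    have j: "n div 2 \<ge> 1" using n by simp
    then have "real (n div 2) * pi > 0" by simp
    then have "\<tau> n > 0" using \<rho>(1)[OF n] unfolding \<tau>_def by linarith
    moreover have "sin (\<tau> n) = 0 \<or> sin (\<tau> n) = \<tau> n * cos (\<tau> n)"
    proof (cases "even n")
      case True
      then show ?thesis by (simp add: \<tau>_def \<rho>_def)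
    next
      case False
      then show ?thesis using r(3)[OF j] by (simp add: \<tau>_def \<rho>_def sin_cos_add_nat_pi)
    qed
    ultimately show ?thesis by blast
  qed
  have surj: "t \<in> \<tau> ` {2..}" if t: "t > 0" "sin t = 0 \<or> sin t = t * cos t" for t
  proof -
    \<comment> \<open>Division of \<open>t\<close> by \<open>pi\<close> with remainder
      \<open>x\<close>. Remainder zero gives an even index; otherwise monotonicity excludes
      \<open>j = 0\<close> and identifies \<open>x\<close> with \<open>r j\<close>.\<close>
    define j where "j = nat \<lfloor>t / pi\<rfloor>"
    define x where "x = t - real j * pi"
    have "real j = of_int \<lfloor>t / pi\<rfloor>" using t by (simp add: j_def)
    then have "real j \<le> t / pi" "t / pi < real j + 1" by linarith+
    then have x: "0 \<le> x" "x < pi" by (auto simp: x_def field_simps)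
    have tx: "t = x + real j * pi" by (simp add: x_def)
    show ?thesis
    proof (cases "x = 0")
      case True
      with t tx have "j \<ge> 1" by (cases j) auto
      moreover have "\<tau> (2 * j) = t" using True tx by (simp add: \<tau>_def \<rho>_def)
      ultimately show ?thesis by (intro image_eqI[of _ _ "2 * j"]) auto
    next
      case False
      then have "sin x > 0" using x by (intro sin_gt_zero) auto
      then have gx: "sin x - (x + real j * pi) * cos x = 0"
        using t(2) unfolding tx sin_cos_add_nat_pi by auto
      have j: "j \<ge> 1"
      proof (rule ccontr)
        assume "\<not> j \<ge> 1"
        then have "j = 0" by simp
        then show False using sin_minus_cos_strict_mono[of 0 0 x] gx x False by simp
      qed
      have "x = r j"
        using sin_minus_cos_strict_mono[of "real j * pi" x "r j"]
          sin_minus_cos_strict_mono[of "real j * pi" "r j" x] gx r(1,2,3)[OF j] x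
        by (cases x "r j" rule: linorder_cases) auto
      then have "\<tau> (2 * j + 1) = t" using tx by (simp add: \<tau>_def \<rho>_def)
      then show ?thesis using j by (intro image_eqI[of _ _ "2 * j + 1"]) auto
    qed
  qed
  have close: "\<bar>(\<tau> n)\<^sup>2 - (real n * (pi / 2))\<^sup>2\<bar> \<le> 6" if n: "n \<ge> 2" for n
  proof (cases "even n")
    case True
    then have "\<tau> n = real n * (pi / 2)" by (auto simp: \<tau>_def \<rho>_def elim!: evenE)
    then show ?thesis by (simp only: diff_self abs_zero)
  next
    case False
    define j where "j = n div 2"
    have j: "j \<ge> 1" using n by (simp add: j_def)
    have "n = 2 * j + 1" using False by (simp add: j_def)
    \<comment> \<open>With \<open>d = pi / 2 - r j\<close> the difference of squares is
      \<open>- (2 * d * \<tau> n + d^2)\<close>. The constant is \<open>6 = 2 * 1 + 2^2\<close>,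
      from \<open>d * \<tau> n \<le> 1\<close> and \<open>d \<le> 2\<close>.\<close>
    then have 1: "real n * (pi / 2) = \<tau> n + (pi / 2 - r j)"
      using False by (simp add: \<tau>_def \<rho>_def j_def[symmetric] field_simps)
    have 2: "(pi / 2 - r j) * \<tau> n \<le> 1" "(pi / 2 - r j) * \<tau> n \<ge> 0"
      using False r(1,2,4)[OF j] char[OF n] by (auto simp: \<tau>_def \<rho>_def j_def[symmetric])
    have "0 \<le> pi / 2 - r j" "pi / 2 - r j \<le> 2" using r(1,2)[OF j] pi_less_4 by linarith+
    then have "(pi / 2 - r j)\<^sup>2 \<le> 2\<^sup>2" by (intro power_mono)
    moreover have "(\<tau> n)\<^sup>2 - (real n * (pi / 2))\<^sup>2 = - (2 * ((pi / 2 - r j) * \<tau> n) + (pi / 2 - r j)\<^sup>2)"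
      unfolding 1 by (simp add: power2_eq_square algebra_simps)
    moreover have "0 \<le> (pi / 2 - r j)\<^sup>2" by simp
    moreover have "\<bar>a\<bar> \<le> 6" if "q \<le> 2\<^sup>2" "a = - (2 * p + q)" "0 \<le> q" "p \<le> 1" "p \<ge> 0" for a p q :: real
      using that by simp
    ultimately show ?thesis using 2 by blast
  qed
  show thesis by (rule that[OF inj]) (use char surj close in auto)
qed

section \<open>Riesz sums over perturbed squares\<close>

lemma sum_of_squares_closed: "(\<Sum>n=1..M. (real n)\<^sup>2) = real M * (real M + 1) * (2 * real M + 1) / 6"
  by (induction M) (auto simp: field_simps power2_eq_square)

text \<open>Writing the upper limit as \<open>r - \<theta>\<close> with \<open>\<theta>\<close> in
  \<open>[0, 1]\<close>, the closed form cancels the cubic and quadratic terms in \<open>r\<close>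
  exactly, leaving terms at most linear in \<open>r\<close>.\<close>

lemma sum_parabola_asymptotics:
  fixes r :: real
  assumes r: "r \<ge> 1"
  shows "\<bar>(\<Sum>n=1..nat \<lfloor>r\<rfloor>. r\<^sup>2 - (real n)\<^sup>2) - (2 / 3 * r ^ 3 - r\<^sup>2 / 2)\<bar> \<le> 3 * r + 1"
proof -
  define M where "M = nat \<lfloor>r\<rfloor>"
  define \<theta> where "\<theta> = r - real M"
  have "real M = of_int \<lfloor>r\<rfloor>" using r by (simp add: M_def)
  then have \<theta>: "0 \<le> \<theta>" "\<theta> \<le> 1" unfolding \<theta>_def by linarith+
  have M: "real M = r - \<theta>" by (simp add: \<theta>_def)
  have "(\<Sum>n=1..M. r\<^sup>2 - (real n)\<^sup>2) - (2 / 3 * r ^ 3 - r\<^sup>2 / 2)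
      = (r * \<theta> + \<theta> ^ 3 / 3 + \<theta> / 6) - (r * \<theta>\<^sup>2 + \<theta>\<^sup>2 / 2 + r / 6)"
    unfolding sum_subtractf sum_of_squares_closed unfolding sum_constant card_atLeastAtMost
    by (simp add: M field_simps power2_eq_square power3_eq_cube)
  moreover have "0 \<le> \<theta> ^ 3" "\<theta> ^ 3 \<le> 1" "0 \<le> \<theta>\<^sup>2" "\<theta>\<^sup>2 \<le> 1" using \<theta> by (auto simp: power_le_one)
  moreover have "r * \<theta> \<le> r * 1" "r * \<theta>\<^sup>2 \<le> r * 1" "0 \<le> r * \<theta>" "0 \<le> r * \<theta>\<^sup>2"
    using r \<theta> by (intro mult_left_mono mult_nonneg_nonneg; simp add: power_le_one)+
  ultimately show ?thesis using \<theta> r unfolding M_def[symmetric] by linarith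
qed

text \<open>The map from \<open>s\<close> to \<open>max (z - s) 0\<close> is 1-Lipschitz, so
  replacing \<open>s n\<close> by \<open>(c * real n)\<^sup>2\<close> costs \<open>K\<close> for
  each of \<open>O(sqrt z)\<close> indices. The sum over exact squares is the parabola sum, rescaled
  by \<open>r = sqrt z / c\<close>, without its first term.\<close>

lemma riesz_sum_perturbed_squares:
  fixes s :: "nat \<Rightarrow> real" and c K :: real
  assumes c: "c > 0" and s: "\<And>n. n \<ge> 2 \<Longrightarrow> \<bar>s n - (c * real n)\<^sup>2\<bar> \<le> K"
  shows "(\<lambda>z. (\<Sum>n | n \<ge> 2 \<and> s n < z. max (z - s n) 0) - (2 / (3 * c) * z powr (3/2) - 3/2 * z))
           \<in> o[at_top](\<lambda>z. z)"
proof -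
  have K: "K \<ge> 0" using s[of 2] by simp
  \<comment> \<open>The parts containing \<open>K\<close> come from the perturbation;
    \<open>3 * c\<close> and one \<open>c\<^sup>2\<close> come from the parabola sum, the other
    \<open>c\<^sup>2\<close> from removing index 1.\<close>
  define A where "A = K / c + 3 * c"
  define B where "B = K * (sqrt K / c + 1) + 2 * c\<^sup>2"
  have arith: "\<bar>R - (P - 3/2 * z)\<bar> \<le> (Q + T) + (W + 2 * C)"
    if "R = R1" "\<bar>R1 - R2\<bar> \<le> E" "R2 = S - (z - C)" "\<bar>S - (P' - z / 2)\<bar> \<le> T + C" "P' = P" "E \<le> Q + W" "0 \<le> C"
    for R R1 R2 E S z C P' P T Q W :: real
    using that by linarith
  have bound: "\<bar>(\<Sum>n | n \<ge> 2 \<and> s n < z. max (z - s n) 0) - (2 / (3 * c) * z powr (3/2) - 3/2 * z)\<bar>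
      \<le> A * sqrt z + B" if z: "z > c\<^sup>2" for z
  proof -
    have z0: "z > 0" using z by (meson le_less_trans zero_le_power2)
    \<comment> \<open>\<open>s n < z\<close> implies \<open>(c * real n)\<^sup>2 < z + K\<close>, so
      with this cutoff the perturbed and the exact sum can both be taken over
      \<open>{2..N}\<close>.\<close>
    define N where "N = nat \<lceil>sqrt (z + K) / c\<rceil>"
    define r where "r = sqrt z / c"
    have zr: "z = c\<^sup>2 * r\<^sup>2" using z0 c by (simp add: r_def power_divide)
    have "c < sqrt z" using z c by (simp add: real_less_rsqrt)
    then have r: "r > 1" using c by (simp add: r_def field_simps)
    have N: "sqrt (z + K) / c \<le> real N" "real N \<le> sqrt (z + K) / c + 1"
      using K z0 c by (auto simp: N_def of_nat_nat) 
    have leN: "n \<le> N" if "(c * real n)\<^sup>2 < z + K" for n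
    proof -
      have "c * real n \<le> sqrt (z + K)" using that by (intro real_le_rsqrt) simp
      then have "real n \<le> sqrt (z + K) / c" using c by (simp add: field_simps)
      then show ?thesis using N by linarith
    qed
    have "(\<Sum>n | n \<ge> 2 \<and> s n < z. max (z - s n) 0) = (\<Sum>n=2..N. max (z - s n) 0)"
    proof (rule sum.mono_neutral_left)
      have "n \<le> N" if "n \<ge> 2" "s n < z" for n
        using s[OF that(1)] that(2) by (intro leN) linarith
      then show "{n. n \<ge> 2 \<and> s n < z} \<subseteq> {2..N}" by auto
    qed auto
    moreover have "\<bar>(\<Sum>n=2..N. max (z - s n) 0) - (\<Sum>n=2..N. max (z - (c * real n)\<^sup>2) 0)\<bar> \<le> real N * K"
    proof -
      have "\<bar>(\<Sum>n=2..N. max (z - s n) 0) - (\<Sum>n=2..N. max (z - (c * real n)\<^sup>2) 0)\<bar>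
         \<le> (\<Sum>n=2..N. \<bar>max (z - s n) 0 - max (z - (c * real n)\<^sup>2) 0\<bar>)"
        unfolding sum_subtractf[symmetric] by (rule sum_abs)
      also have "\<dots> \<le> (\<Sum>n=2..N. K)"
      proof (rule sum_mono)
        fix n assume "n \<in> {2..N}"
        then show "\<bar>max (z - s n) 0 - max (z - (c * real n)\<^sup>2) 0\<bar> \<le> K"
          using s[of n] by (auto simp: max_def)
      qed
      also have "\<dots> \<le> real N * K" using K by (simp add: mult_right_mono)
      finally show ?thesis .
    qed
    moreover have "(\<Sum>n=2..N. max (z - (c * real n)\<^sup>2) 0) = c\<^sup>2 * (\<Sum>n=1..nat \<lfloor>r\<rfloor>. r\<^sup>2 - (real n)\<^sup>2) - (z - c\<^sup>2)"
    proof -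
      have le: "max (z - (c * real n)\<^sup>2) 0 = (if n \<le> nat \<lfloor>r\<rfloor> then c\<^sup>2 * (r\<^sup>2 - (real n)\<^sup>2) else 0)" for n
      proof (cases "n \<le> nat \<lfloor>r\<rfloor>")
        case True
        then have "real n \<le> r" using r by linarith
        then have "(real n)\<^sup>2 \<le> r\<^sup>2" by (intro power_mono) auto
        then have "0 \<le> c\<^sup>2 * (r\<^sup>2 - (real n)\<^sup>2)" by simp
        then show ?thesis using True by (simp add: zr power_mult_distrib algebra_simps)
      next
        case False
        then have "r \<le> real n" by linarith
        then have "r\<^sup>2 \<le> (real n)\<^sup>2" using r by (intro power_mono) auto
        then have "c\<^sup>2 * r\<^sup>2 \<le> c\<^sup>2 * (real n)\<^sup>2" by (intro mult_left_mono) auto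
        then show ?thesis using False by (simp add: zr power_mult_distrib)
      qed
      have NM: "nat \<lfloor>r\<rfloor> \<le> N"
      proof -
        have "r \<le> sqrt (z + K) / c" unfolding r_def using c K by (intro divide_right_mono) auto
        then show ?thesis using N r by linarith
      qed
      have M1: "1 \<le> nat \<lfloor>r\<rfloor>" using r by linarith
      have "(\<Sum>n=2..N. max (z - (c * real n)\<^sup>2) 0) = (\<Sum>n=2..nat \<lfloor>r\<rfloor>. c\<^sup>2 * (r\<^sup>2 - (real n)\<^sup>2))"
        unfolding le using NM by (intro sum.mono_neutral_cong_right) auto
      \<comment> \<open>Since \<open>z > c\<^sup>2\<close> gives \<open>r > 1\<close>, index 1 does
        occur in the full sum. Its term is \<open>z - c\<^sup>2\<close>, the source of the
        additional \<open>- z\<close>.\<close>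
      also have "\<dots> = (\<Sum>n=1..nat \<lfloor>r\<rfloor>. c\<^sup>2 * (r\<^sup>2 - (real n)\<^sup>2)) - c\<^sup>2 * (r\<^sup>2 - 1)"
        using sum.atLeast_Suc_atMost[OF M1, of "\<lambda>n. c\<^sup>2 * (r\<^sup>2 - (real n)\<^sup>2)"] by (simp add: numeral_2_eq_2)
      also have "\<dots> = c\<^sup>2 * (\<Sum>n=1..nat \<lfloor>r\<rfloor>. r\<^sup>2 - (real n)\<^sup>2) - (z - c\<^sup>2)"
        unfolding zr sum_distrib_left by (simp add: algebra_simps)
      finally show ?thesis .
    qed
    moreover have "\<bar>c\<^sup>2 * (\<Sum>n=1..nat \<lfloor>r\<rfloor>. r\<^sup>2 - (real n)\<^sup>2) - (c\<^sup>2 * (2 / 3 * r ^ 3) - z / 2)\<bar> \<le> 3 * c * sqrt z + c\<^sup>2"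
    proof -
      have "c\<^sup>2 * \<bar>(\<Sum>n=1..nat \<lfloor>r\<rfloor>. r\<^sup>2 - (real n)\<^sup>2) - (2 / 3 * r ^ 3 - r\<^sup>2 / 2)\<bar> \<le> c\<^sup>2 * (3 * r + 1)"
        using sum_parabola_asymptotics[of r] r by (intro mult_left_mono) auto
      moreover have "c\<^sup>2 * (3 * r + 1) = 3 * c * sqrt z + c\<^sup>2"
        using c by (simp add: r_def field_simps power2_eq_square)
      moreover have "c\<^sup>2 * \<bar>(\<Sum>n=1..nat \<lfloor>r\<rfloor>. r\<^sup>2 - (real n)\<^sup>2) - (2 / 3 * r ^ 3 - r\<^sup>2 / 2)\<bar>
        = \<bar>c\<^sup>2 * ((\<Sum>n=1..nat \<lfloor>r\<rfloor>. r\<^sup>2 - (real n)\<^sup>2) - (2 / 3 * r ^ 3 - r\<^sup>2 / 2))\<bar>"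
        by (simp add: abs_mult)
      moreover have "c\<^sup>2 * ((\<Sum>n=1..nat \<lfloor>r\<rfloor>. r\<^sup>2 - (real n)\<^sup>2) - (2 / 3 * r ^ 3 - r\<^sup>2 / 2))
         = c\<^sup>2 * (\<Sum>n=1..nat \<lfloor>r\<rfloor>. r\<^sup>2 - (real n)\<^sup>2) - (c\<^sup>2 * (2 / 3 * r ^ 3) - z / 2)"
        by (simp add: zr algebra_simps)
      ultimately show ?thesis by simp
    qed
    moreover have "c\<^sup>2 * (2 / 3 * r ^ 3) = 2 / (3 * c) * z powr (3/2)"
    proof -
      have "z powr (3/2) = sqrt z ^ 3"
        using z0 by (simp add: powr_half_sqrt[symmetric] powr_power)
      then show ?thesis using c by (simp add: r_def field_simps power2_eq_square power3_eq_cube)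
    qed
    moreover have "real N * K \<le> K / c * sqrt z + K * (sqrt K / c + 1)"
    proof -
      have "sqrt (z + K) \<le> sqrt z + sqrt K" using z0 K by (intro sqrt_add_le_add_sqrt) auto
      then have "sqrt (z + K) / c \<le> sqrt z / c + sqrt K / c"
        using c by (simp add: divide_right_mono flip: add_divide_distrib)
      then have "real N \<le> sqrt z / c + sqrt K / c + 1" using N by linarith
      then have "real N * K \<le> (sqrt z / c + sqrt K / c + 1) * K" using K by (rule mult_right_mono)
      then show ?thesis by (simp add: algebra_simps)
    qed
    moreover have "0 \<le> c\<^sup>2" by simp
    ultimately show ?thesis
      unfolding A_def B_def distrib_right by (rule arith)
  qed
  have "(\<lambda>z. (\<Sum>n | n \<ge> 2 \<and> s n < z. max (z - s n) 0) - (2 / (3 * c) * z powr (3/2) - 3/2 * z))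
     \<in> O[at_top](\<lambda>z. A * sqrt z + B)"
  proof (rule landau_o.bigI[of 1])
    show "\<forall>\<^sub>F z in at_top. norm ((\<Sum>n | n \<ge> 2 \<and> s n < z. max (z - s n) 0) - (2 / (3 * c) * z powr (3/2) - 3/2 * z))
      \<le> 1 * norm (A * sqrt z + B)"
      using eventually_gt_at_top[of "c\<^sup>2"]
    proof eventually_elim
      case (elim z)
      then show ?case using bound[of z] by (auto intro: order_trans)
    qed
  qed simp
  also have "(\<lambda>z. A * sqrt z + B) \<in> o[at_top](\<lambda>z::real. z)"
  proof (rule sum_in_smallo)
    have nonzero: "\<forall>\<^sub>F z::real in at_top. z \<noteq> 0"
      using eventually_gt_at_top[of 0] by eventually_elim simp
    have "(\<lambda>z::real. sqrt z) \<in> o[at_top](\<lambda>z. z)" 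
    proof (rule smalloI_tendsto)
      have "((\<lambda>z::real. inverse (sqrt z)) \<longlongrightarrow> 0) at_top"
        by (rule tendsto_inverse_0_at_top[OF sqrt_at_top])
      moreover have "\<forall>\<^sub>F z::real in at_top. inverse (sqrt z) = sqrt z / z"
        using eventually_gt_at_top[of 0]
        by eventually_elim (simp add: sqrt_divide_self_eq)
      ultimately show "((\<lambda>z::real. sqrt z / z) \<longlongrightarrow> 0) at_top"
        by (rule Lim_transform_eventually)
    qed (rule nonzero)
    then show "(\<lambda>z. A * sqrt z) \<in> o[at_top](\<lambda>z::real. z)" by simp
    show "(\<lambda>z. B) \<in> o[at_top](\<lambda>z::real. z)"
    proof (rule smalloI_tendsto)
      show "((\<lambda>z. B / z) \<longlongrightarrow> 0) at_top"
        by (rule tendsto_divide_0[OF tendsto_const filterlim_at_top_imp_at_infinity[OF filterlim_ident]])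
    qed (rule nonzero)
  qed
  finally show ?thesis .
qed

section \<open>From characteristic roots to the eigenvalue asymptotics\<close>

lemma buckling_eigenvalues_eq:
  assumes "L > 0"
  shows "{\<sigma>. buckling_eigenvalue L \<sigma>} = (\<lambda>t. (2 * t / L)\<^sup>2) ` {t. t > 0 \<and> (sin t = 0 \<or> sin t = t * cos t)}"
proof (intro equalityI subsetI)
  fix \<sigma> assume "\<sigma> \<in> {\<sigma>. buckling_eigenvalue L \<sigma>}"
  then have ev: "buckling_eigenvalue L \<sigma>" by simp
  let ?t = "sqrt \<sigma> * L / 2"
  have "\<sigma> > 0" using buckling_eigenvalue_pos[OF assms ev] .
  then have "\<sigma> = (2 * ?t / L)\<^sup>2" "?t > 0" using assms by auto
  then show "\<sigma> \<in> (\<lambda>t. (2 * t / L)\<^sup>2) ` {t. t > 0 \<and> (sin t = 0 \<or> sin t = t * cos t)}"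
    using buckling_eigenvalueD[OF assms ev] by (intro image_eqI[of _ _ ?t]) auto
next
  fix \<sigma> assume "\<sigma> \<in> (\<lambda>t. (2 * t / L)\<^sup>2) ` {t. t > 0 \<and> (sin t = 0 \<or> sin t = t * cos t)}"
  then obtain t where t: "t > 0" "sin t = 0 \<or> sin t = t * cos t" "\<sigma> = (2 * t / L)\<^sup>2" by auto
  have "sqrt \<sigma> * L / 2 = t" using t(1) assms unfolding t(3) by simp
  moreover have "\<sigma> > 0" using t(1) assms unfolding t(3) by simp
  ultimately show "\<sigma> \<in> {\<sigma>. buckling_eigenvalue L \<sigma>}"
    using buckling_eigenvalueI[OF assms, of \<sigma>] t(2) by simp
qed

theorem theorem1p4:
  fixes L :: real
  assumes "L > 0"
  shows "(\<lambda>z. riesz_mean1 L z - (2 * L / (3 * pi) * z powr (3/2) - 3/2 * z))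
           \<in> o[at_top](\<lambda>z. z)"
proof -
  obtain \<tau> :: "nat \<Rightarrow> real" where inj: "inj_on \<tau> {2..}"
    and image: "\<tau> ` {2..} = {t. t > 0 \<and> (sin t = 0 \<or> sin t = t * cos t)}"
    and close: "\<forall>n\<ge>2. \<bar>(\<tau> n)\<^sup>2 - (real n * (pi / 2))\<^sup>2\<bar> \<le> 6"
    by (rule enumerate_characteristic_roots)
  define s where "s n = (2 * \<tau> n / L)\<^sup>2" for n
  have pos: "\<tau> n > 0" if "n \<ge> 2" for n using image that by (auto simp: set_eq_iff)
  \<comment> \<open>\<open>riesz_mean1\<close> sums over the set of eigenvalues, so injectivity is
    what allows summation over indices instead.\<close>
  have inj_s: "inj_on s {2..}"
  proof (rule inj_onI)
    fix m n assume mn: "m \<in> {2..}" "n \<in> {2..}" "s m = s n"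
    then have "(2 * \<tau> m / L)\<^sup>2 = (2 * \<tau> n / L)\<^sup>2" by (simp add: s_def)
    moreover have "0 \<le> 2 * \<tau> m / L" "0 \<le> 2 * \<tau> n / L" using pos[of m] pos[of n] mn assms by auto
    ultimately have "2 * \<tau> m / L = 2 * \<tau> n / L" by (rule power2_eq_imp_eq)
    then have "\<tau> m = \<tau> n" using assms by simp
    then show "m = n" using inj mn by (auto dest: inj_onD)
  qed
  have ev: "{\<sigma>. buckling_eigenvalue L \<sigma>} = s ` {2..}"
    unfolding buckling_eigenvalues_eq[OF assms] image[symmetric] image_image s_def ..
  have riesz: "riesz_mean1 L z = (\<Sum>n | n \<ge> 2 \<and> s n < z. max (z - s n) 0)" for z
  proof -
    have eq: "{\<sigma>. buckling_eigenvalue L \<sigma> \<and> \<sigma> < z} = s ` {n. n \<ge> 2 \<and> s n < z}"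
      using ev by auto
    have "inj_on s {n. n \<ge> 2 \<and> s n < z}" by (rule inj_on_subset[OF inj_s]) auto
    then show ?thesis unfolding riesz_mean1_def eq by (simp only: sum.reindex o_def)
  qed
  \<comment> \<open>The factor \<open>4 / L\<^sup>2\<close> carries the root estimate over to
    eigenvalues, giving \<open>K = 24 / L\<^sup>2\<close> and \<open>c = pi / L\<close>, the spacing
    of the square roots of the Dirichlet eigenvalues.\<close>
  have "\<bar>s n - (pi / L * real n)\<^sup>2\<bar> \<le> 24 / L\<^sup>2" if "n \<ge> 2" for n
  proof -
    have "s n - (pi / L * real n)\<^sup>2 = 4 / L\<^sup>2 * ((\<tau> n)\<^sup>2 - (real n * (pi / 2))\<^sup>2)"
      using assms by (simp add: s_def field_simps)
    also have "\<bar>\<dots>\<bar> = 4 / L\<^sup>2 * \<bar>(\<tau> n)\<^sup>2 - (real n * (pi / 2))\<^sup>2\<bar>"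
      unfolding abs_mult by simp
    also have "\<dots> \<le> 4 / L\<^sup>2 * 6" using close that by (intro mult_left_mono) auto
    finally show ?thesis by simp
  qed
  then have "(\<lambda>z. riesz_mean1 L z - (2 / (3 * (pi / L)) * z powr (3/2) - 3/2 * z)) \<in> o[at_top](\<lambda>z. z)"
    unfolding riesz using assms by (intro riesz_sum_perturbed_squares) auto
  then show ?thesis by simp
qed

end
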